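(* For the relevant integers $n,s$ put $H_{n,s}=K_s\vee(sK_1\cup K_{n-2s})$ and $L_{n,s}=K_{s-1}\vee(sK_1\cup K_{n-2s+1})$. The following statements hold. (i) If $\mathcal P$ is a weakly feasible graph parameter and $d\ge1$, $n\ge2d+1$ are integers, then $$\mathrm{ex}_{\mathcal P}(n,C_n;\delta\ge d)=\max_{d\le s\le\lfloor(n-1)/2\rfloor}\mathcal P(H_{n,s}).$$ (ii) If $\mathcal P$ is a weakly feasible graph parameter and $d\ge1$, $n\ge2d+2$ are integers, then $$\mathrm{ex}_{\mathcal P}(n,P_n;\delta\ge d)=\max_{d+1\le s\le\lfloor n/2\rfloor}\mathcal P(L_{n,s}).$$
   Context: All graphs are finite and simple. A graph parameter is a real-valued isomorphism invariant of graphs. $H_1\cup H_2$ denotes disjoint union and $H_1\vee H_2$ denotes join (disjoint union plus all edges between the two graphs); $sK_1$ is the edgeless graph on $s$ vertices. $\delta$ is the minimum degree. $C_n$ and $P_n$ are the cycle and the path with $n$ vertices. Kelmans operation: for distinct vertices $x,y$ of a graph $G$, let $W=N_G(x)\setminus N_G[y]$, where $N_G[y]=N_G(y)\cup\{y\}$, and let $G[x\to y]=G-\{xw:w\in W\}+\{yw:w\in W\}$. A graph parameter $\mathcal P$ is weakly feasible if for every graph $G$ (connected or not): (W1) $\mathcal P(G+F)\ge\mathcal P(G)$ for every set $F\subseteq\binom{V(G)}2\setminus E(G)$ such that $G+F$ is connected, where $G+F$ has vertex set $V(G)$ and edge set $E(G)\cup F$; (W2) $\mathcal P(G[x\to y])\ge\mathcal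 P(G)$ for every ordered pair of distinct vertices $x,y\in V(G)$. For a graph $F$, $\mathrm{ex}_{\mathcal P}(n,F;\delta\ge d)$ is the maximum of $\mathcal P$ over all graphs of order $n$ and minimum degree at least $d$ that contain no copy of $F$ (as a subgraph). *)

theory Defs
  imports Complex_Main "HOL-Library.Ramsey"
begin

datatype 'a graph = Graph (verts: "'a set") (edges: "'a set set")

definition simple_graph :: "'a graph \<Rightarrow> bool" where
  "simple_graph G \<longleftrightarrow> finite (verts G) \<and> edges G \<subseteq> nsets (verts G) 2"

definition nbhd :: "'a graph \<Rightarrow> 'a \<Rightarrow> 'a set" where
  "nbhd G x = {y \<in> verts G. {x, y} \<in> edges G}"

definition closed_nbhd :: "'a graph \<Rightarrow> 'a \<Rightarrow> 'a set" where
  "closed_nbhd G x = insert x (nbhd G x)"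

definition order :: "'a graph \<Rightarrow> nat" where
  "order G = card (verts G)"

definition degree :: "'a graph \<Rightarrow> 'a \<Rightarrow> nat" where
  "degree G x = card (nbhd G x)"

definition min_degree :: "'a graph \<Rightarrow> nat" where
  "min_degree G = Min (degree G ` verts G)"

definition connected_graph :: "'a graph \<Rightarrow> bool" where
  "connected_graph G \<longleftrightarrow>
     (\<forall>u \<in> verts G. \<forall>v \<in> verts G. (u, v) \<in> {(x, y). {x, y} \<in> edges G}\<^sup>*)"

definition graph_iso :: "'a graph \<Rightarrow> 'b graph \<Rightarrow> bool" where
  "graph_iso G H \<longleftrightarrow> (\<exists>f. bij_betw f (verts G) (verts H) \<and>
     (\<forall>x \<in> verts G. \<forall>y \<in> verts G. {x, y} \<in> edges G \<longleftrightarrow> {f x, f y} \<in> edges H))"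

text \<open>Copies are not required to be induced.\<close>

definition contains_copy :: "'a graph \<Rightarrow> 'b graph \<Rightarrow> bool" where
  "contains_copy G F \<longleftrightarrow> (\<exists>f. inj_on f (verts F) \<and> f ` verts F \<subseteq> verts G \<and>
     (\<forall>e \<in> edges F. f ` e \<in> edges G))"

definition add_edges :: "'a graph \<Rightarrow> 'a set set \<Rightarrow> 'a graph" where
  "add_edges G F = Graph (verts G) (edges G \<union> F)"

definition kelmans :: "'a graph \<Rightarrow> 'a \<Rightarrow> 'a \<Rightarrow> 'a graph" where
  "kelmans G x y = (let W = nbhd G x - closed_nbhd G y in
     Graph (verts G) ((edges G - {{x, w} | w. w \<in> W}) \<union> {{y, w} | w. w \<in> W}))"

text \<open>
  Every finite graph is isomorphic to one whose vertices are natural numbers, so an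
  isomorphism invariant of finite graphs is the same thing as an isomorphism invariant of
  finite graphs with vertices in \<^typ>\<open>nat\<close>. The values of \<open>P\<close> at
  terms of type \<^typ>\<open>nat graph\<close> that are not simple graphs are irrelevant.
\<close>

definition graph_parameter :: "(nat graph \<Rightarrow> real) \<Rightarrow> bool" where
  "graph_parameter P \<longleftrightarrow>
     (\<forall>G H. simple_graph G \<and> simple_graph H \<and> graph_iso G H \<longrightarrow> P G = P H)"

definition weakly_feasible :: "(nat graph \<Rightarrow> real) \<Rightarrow> bool" where
  "weakly_feasible P \<longleftrightarrow>
     (\<forall>G F. simple_graph G \<and> F \<subseteq> nsets (verts G) 2 - edges G \<and> connected_graph (add_edges G F)
        \<longrightarrow> P (add_edges G F) \<ge> P G) \<and>
     (\<forall>G x y. simple_graph G \<and> x \<in> verts G \<and> y \<in> verts G \<and> x \<noteq> y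
        \<longrightarrow> P (kelmans G x y) \<ge> P G)"

definition complete_graph :: "nat \<Rightarrow> nat graph" where
  "complete_graph n = Graph {..<n} (nsets {..<n} 2)"

definition edgeless_graph :: "nat \<Rightarrow> nat graph" where
  "edgeless_graph n = Graph {..<n} {}"

text \<open>This is the cycle only for \<open>n \<ge> 3\<close>.\<close>

definition cycle_graph :: "nat \<Rightarrow> nat graph" where
  "cycle_graph n = Graph {..<n} {{i, Suc i mod n} | i. i < n}"

definition path_graph :: "nat \<Rightarrow> nat graph" where
  "path_graph n = Graph {..<n} {{i, Suc i} | i. Suc i < n}"

definition map_verts :: "('a \<Rightarrow> 'b) \<Rightarrow> 'a graph \<Rightarrow> 'b graph" where
  "map_verts f G = Graph (f ` verts G) ((`) f ` edges G)"

text \<open>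
  To stay within vertices of type \<^typ>\<open>nat\<close>, disjoint copies of the two graphs are
  placed on even and on odd numbers, respectively.
\<close>

definition disjoint_union :: "nat graph \<Rightarrow> nat graph \<Rightarrow> nat graph" where
  "disjoint_union G H = (let G' = map_verts (\<lambda>v. 2 * v) G; H' = map_verts (\<lambda>v. 2 * v + 1) H in
     Graph (verts G' \<union> verts H') (edges G' \<union> edges H'))"

definition join :: "nat graph \<Rightarrow> nat graph \<Rightarrow> nat graph" where
  "join G H = add_edges (disjoint_union G H)
     {{2 * u, 2 * v + 1} | u v. u \<in> verts G \<and> v \<in> verts H}"

definition H_graph :: "nat \<Rightarrow> nat \<Rightarrow> nat graph" where
  "H_graph n s = join (complete_graph s)
     (disjoint_union (edgeless_graph s) (complete_graph (n - 2 * s)))"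

definition L_graph :: "nat \<Rightarrow> nat \<Rightarrow> nat graph" where
  "L_graph n s = join (complete_graph (s - 1))
     (disjoint_union (edgeless_graph s) (complete_graph (n - 2 * s + 1)))"

definition admissible :: "nat \<Rightarrow> 'b graph \<Rightarrow> nat \<Rightarrow> nat graph set" where
  "admissible n F d = {G. simple_graph G \<and> order G = n \<and> min_degree G \<ge> d \<and> \<not> contains_copy G F}"

text \<open>
  There are infinitely many admissible graphs with vertices in \<^typ>\<open>nat\<close>, but a graph
  parameter takes only finitely many values on them (lemma \<open>finite_values\<close> below), so
  \<^const>\<open>Max\<close> is the maximum as soon as there is an admissible graph.
\<close>

definition ex_param :: "(nat graph \<Rightarrow> real) \<Rightarrow> nat \<Rightarrow> 'b graph \<Rightarrow> nat \<Rightarrow> real" where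
  "ex_param P n F d = Max (P ` admissible n F d)"

lemma finite_values:
  assumes P: "graph_parameter P"
  shows "finite (P ` admissible n F d)"
proof -
  let ?S = "(\<lambda>E. Graph {..<n} E) ` Pow (nsets {..<n} 2)"
  have "finite ?S"
    by (simp add: finite_imp_finite_nsets)
  moreover have "P ` admissible n F d \<subseteq> P ` ?S"
  proof (rule image_subsetI)
    fix G assume that: "G \<in> admissible n F d"
    have G: "finite (verts G)" "edges G \<subseteq> nsets (verts G) 2" "card (verts G) = n"
      using that by (auto simp: admissible_def simple_graph_def order_def)
    obtain f where f: "bij_betw f (verts G) {..<n}"
      using finite_same_card_bij[OF G(1), of "{..<n}"] G(3) by auto
    define E where "E = (`) f ` edges G"
    have inj: "inj_on f (verts G)" and im: "f ` verts G = {..<n}"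
      using f by (auto simp: bij_betw_def)
    have E: "E \<subseteq> nsets {..<n} 2"
    proof
      fix e' assume "e' \<in> E"
      then obtain e where e: "e \<in> edges G" "e' = f ` e" by (auto simp: E_def)
      then have "e \<subseteq> verts G" "finite e" "card e = 2"
        using G(2) by (auto simp: nsets_def)
      then show "e' \<in> nsets {..<n} 2"
        using e im inj by (auto simp: nsets_def card_image inj_on_subset)
    qed
    have "{x, y} \<in> edges G \<longleftrightarrow> {f x, f y} \<in> E" if xy: "x \<in> verts G" "y \<in> verts G" for x y
    proof
      assume "{f x, f y} \<in> E"
      then obtain e where e: "e \<in> edges G" "f ` e = f ` {x, y}" by (auto simp: E_def)
      moreover have "e \<subseteq> verts G" using e G(2) by (auto simp: nsets_def)
      ultimately have "e = {x, y}"
        using inj_on_image_eq_iff[OF inj, of e "{x, y}"] xy by simp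
      then show "{x, y} \<in> edges G" using e by simp
    next
      assume "{x, y} \<in> edges G"
      then have "f ` {x, y} \<in> E" unfolding E_def by (rule imageI)
      then show "{f x, f y} \<in> E" by simp
    qed
    then have "graph_iso G (Graph {..<n} E)"
      using f by (auto simp: graph_iso_def)
    moreover have "simple_graph (Graph {..<n} E)" "simple_graph G"
      using E G by (auto simp: simple_graph_def)
    ultimately have "P G = P (Graph {..<n} E)"
      using P by (auto simp: graph_parameter_def)
    then show "P G \<in> P ` ?S" using E by auto
  qed
  ultimately show ?thesis by (meson finite_imageI finite_subset)
qed

end

theory Submission
  imports Defs
begin

text \<open>
  If \<open>G\<close> has \<open>n\<close> vertices and no Hamilton cycle, Chvatal's argument gives a set \<open>S\<close> of
  \<open>s < n / 2\<close> vertices of degree at most \<open>s\<close>, where \<open>s\<close> is at least the minimum degree. Kelmans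
  operations with targets outside \<open>S\<close> never raise a degree in \<open>S\<close>. Once none of them makes
  progress, \<open>S\<close> is independent, because a vertex of \<open>S\<close> with a neighbour in \<open>S\<close> would be
  adjacent to everything outside \<open>S\<close>; and the neighbourhoods of the vertices of \<open>S\<close> form a chain,
  so that they all lie in one set of \<open>s\<close> vertices. The graph is then a subgraph of \<open>H_graph n s\<close>.
  The minimum degree may drop on the way, but only \<open>s\<close> matters in the end. Adding a
  dominating vertex reduces Hamilton paths to Hamilton cycles.
\<close>

section \<open>Neighbourhoods and degrees in simple graphs\<close>

lemma doubleton_in_nsets2 [simp]: "{x, y} \<in> nsets V 2 \<longleftrightarrow> x \<in> V \<and> y \<in> V \<and> x \<noteq> y"
  by (auto simp: nsets_def card_insert_if)

lemma in_nsets2E: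
  assumes "e \<in> nsets V 2"
  obtains x y where "e = {x, y}" "x \<in> V" "y \<in> V" "x \<noteq> y"
  using assms by (auto simp: nsets_def card_2_iff)

lemma simple_graphD:
  assumes "simple_graph G" "{x, y} \<in> edges G"
  shows "x \<in> verts G" "y \<in> verts G" "x \<noteq> y"
proof -
  have "{x, y} \<in> nsets (verts G) 2" using assms by (auto simp only: simple_graph_def)
  then show "x \<in> verts G" "y \<in> verts G" "x \<noteq> y" by simp_all
qed

lemma finite_verts: "simple_graph G \<Longrightarrow> finite (verts G)"
  by (simp add: simple_graph_def)

lemma finite_nbhd: "simple_graph G \<Longrightarrow> finite (nbhd G x)"
  by (simp add: nbhd_def finite_verts)

lemma in_nbhd_iff: "simple_graph G \<Longrightarrow> y \<in> nbhd G x \<longleftrightarrow> {x, y} \<in> edges G"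
  by (auto simp: nbhd_def dest: simple_graphD)

lemma nbhd_sym: "simple_graph G \<Longrightarrow> y \<in> nbhd G x \<longleftrightarrow> x \<in> nbhd G y"
  by (simp add: in_nbhd_iff insert_commute)

lemma not_in_nbhd_self: "simple_graph G \<Longrightarrow> x \<notin> nbhd G x"
  using simple_graphD(3)[of G x x] by (auto simp: in_nbhd_iff)

lemma nbhd_subset_verts: "nbhd G x \<subseteq> verts G"
  by (auto simp: nbhd_def)

lemma degree_mono:
  assumes "simple_graph H" "verts G = verts H" "edges G \<subseteq> edges H"
  shows "degree G x \<le> degree H x"
  unfolding degree_def
  by (rule card_mono) (use assms in \<open>auto simp: finite_verts nbhd_def\<close>)

lemma min_degree_le:
  assumes "simple_graph G" "x \<in> verts G"
  shows "min_degree G \<le> degree G x"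
  using assms by (simp add: min_degree_def finite_verts)


section \<open>Hamilton cycles and degrees\<close>

definition ham_cycle :: "'a graph \<Rightarrow> (nat \<Rightarrow> 'a) \<Rightarrow> bool" where
  "ham_cycle G f \<longleftrightarrow> bij_betw f {..<order G} (verts G) \<and>
     (\<forall>i < order G. {f i, f (Suc i mod order G)} \<in> edges G)"

definition ham_path :: "'a graph \<Rightarrow> (nat \<Rightarrow> 'a) \<Rightarrow> bool" where
  "ham_path G f \<longleftrightarrow> bij_betw f {..<order G} (verts G) \<and>
     (\<forall>i. Suc i < order G \<longrightarrow> {f i, f (Suc i)} \<in> edges G)"

text \<open>Only at the last index does \<open>mod\<close> wrap around; that index contributes the
  closing edge, all others the path.\<close>

lemma ham_cycle_iff_ham_path:
  assumes "order G > 0"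
  shows "ham_cycle G f \<longleftrightarrow> ham_path G f \<and> {f (order G - 1), f 0} \<in> edges G"
proof -
  have "(\<forall>i < order G. {f i, f (Suc i mod order G)} \<in> edges G) \<longleftrightarrow>
    (\<forall>i. Suc i < order G \<longrightarrow> {f i, f (Suc i)} \<in> edges G) \<and> {f (order G - 1), f 0} \<in> edges G"
    (is "?L \<longleftrightarrow> ?R")
  proof
    assume L: ?L
    then have "{f (order G - 1), f 0} \<in> edges G"
      using assms by (auto dest: spec[of _ "order G - 1"])
    moreover have "{f i, f (Suc i)} \<in> edges G" if "Suc i < order G" for i
      using L[rule_format, of i] that by simp
    ultimately show ?R using assms by simp
  next
    assume R: ?R
    show ?L
    proof (intro allI impI)
      fix i assume "i < order G"
      then consider "Suc i < order G" | "i = order G - 1" by linarith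
      then show "{f i, f (Suc i mod order G)} \<in> edges G"
        by cases (use R assms in auto)
    qed
  qed
  then show ?thesis by (auto simp: ham_cycle_def ham_path_def)
qed

lemma bij_betw_of_card:
  assumes "finite V" "inj_on f {..<card V}" "f ` {..<card V} \<subseteq> V"
  shows "bij_betw f {..<card V} V"
  using assms card_subset_eq[of V "f ` {..<card V}"]
  by (simp add: bij_betw_def card_image)

text \<open>An injection from a vertex set of the same finite size is onto, so a copy of the
  spanning cycle is a cyclic enumeration of all vertices.\<close>

lemma contains_cycle_iff:
  assumes "finite (verts G)"
  shows "contains_copy G (cycle_graph (order G)) \<longleftrightarrow> (\<exists>f. ham_cycle G f)"
proof -
  have "inj_on f {..<order G} \<and> f ` {..<order G} \<subseteq> verts G \<longleftrightarrow> bij_betw f {..<order G} (verts G)" for f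
    using assms bij_betw_of_card[of "verts G" f] by (auto simp: bij_betw_def order_def)
  moreover have "(\<forall>e \<in> edges (cycle_graph (order G)). f ` e \<in> edges G) \<longleftrightarrow>
    (\<forall>i < order G. {f i, f (Suc i mod order G)} \<in> edges G)" for f
    by (simp add: cycle_graph_def setcompr_eq_image)
  ultimately show ?thesis
    unfolding contains_copy_def ham_cycle_def by (simp add: cycle_graph_def) blast
qed

lemma contains_path_iff:
  assumes "finite (verts G)"
  shows "contains_copy G (path_graph (order G)) \<longleftrightarrow> (\<exists>f. ham_path G f)"
proof -
  have "inj_on f {..<order G} \<and> f ` {..<order G} \<subseteq> verts G \<longleftrightarrow> bij_betw f {..<order G} (verts G)" for f
    using assms bij_betw_of_card[of "verts G" f] by (auto simp: bij_betw_def order_def)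
  moreover have "(\<forall>e \<in> edges (path_graph (order G)). f ` e \<in> edges G) \<longleftrightarrow>
    (\<forall>i. Suc i < order G \<longrightarrow> {f i, f (Suc i)} \<in> edges G)" for f
    by (simp add: path_graph_def setcompr_eq_image)
  ultimately show ?thesis
    unfolding contains_copy_def ham_path_def by (simp add: path_graph_def) blast
qed

text \<open>A cyclic shift of the enumeration turns any chosen edge of the cycle into its closing
  edge, so that this edge can then be removed to leave a path.\<close>

lemma ham_cycle_rotate:
  assumes f: "ham_cycle G f" and m: "m < order G"
  obtains g where "ham_cycle G g" "g (order G - 1) = f m" "g 0 = f (Suc m mod order G)"
proof -
  define n where "n = order G"
  define r where "r j = (Suc m + j) mod n" for j
  have n: "m < n" using m by (simp add: n_def)
  have "r j = (if Suc m + j < n then Suc m + j else Suc m + j - n)" if "j < n" for j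
    using that n by (simp add: r_def le_mod_geq)
  then have "inj_on r {..<n}" using n by (auto simp: inj_on_def split: if_splits)
  moreover have "r ` {..<n} \<subseteq> {..<n}" using n by (auto simp: r_def)
  ultimately have "bij_betw r {..<n} {..<n}"
    using bij_betw_of_card[of "{..<n}" r] by simp
  then have "bij_betw (f \<circ> r) {..<n} (verts G)"
    using f by (auto simp: ham_cycle_def n_def intro: bij_betw_trans)
  moreover have "r (Suc i mod n) = Suc (r i) mod n" for i
    by (simp only: r_def mod_add_right_eq mod_Suc_eq add_Suc_right)
  then have "{(f \<circ> r) i, (f \<circ> r) (Suc i mod n)} \<in> edges G" for i
    using f n by (simp add: ham_cycle_def n_def r_def)
  ultimately have "ham_cycle G (f \<circ> r)" by (simp add: ham_cycle_def n_def)
  moreover have "(f \<circ> r) (order G - 1) = f m" "(f \<circ> r) 0 = f (Suc m mod order G)"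
    using n by (auto simp: r_def n_def)
  ultimately show thesis by (rule that)
qed

text \<open>The cycle runs from \<open>g 0\<close> to \<open>g i\<close>, jumps to the last vertex,
  follows the path backwards to \<open>g (Suc i)\<close> and closes up at
  \<open>g 0\<close>.\<close>

lemma ham_path_flip:
  assumes p: "ham_path G g" and i: "Suc i < order G"
    and e: "{g (order G - 1), g i} \<in> edges G" "{g 0, g (Suc i)} \<in> edges G"
  shows "\<exists>h. ham_cycle G h"
proof -
  define n where "n = order G"
  \<comment> \<open>After position \<open>i\<close> the values run from \<open>n - 1\<close> down to
    \<open>Suc i\<close>.\<close>
  define r where "r j = (if j \<le> i then j else n + i - j)" for j
  have i': "Suc i < n" using i by (simp add: n_def)
  have "inj_on r {..<n}"
    using i' by (auto simp: inj_on_def r_def split: if_splits)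
  moreover have "r ` {..<n} \<subseteq> {..<n}" using i' by (auto simp: r_def)
  ultimately have "bij_betw r {..<n} {..<n}"
    using bij_betw_of_card[of "{..<n}" r] by simp
  then have "bij_betw (g \<circ> r) {..<n} (verts G)"
    using p by (auto simp: ham_path_def n_def intro: bij_betw_trans)
  moreover have "{(g \<circ> r) j, (g \<circ> r) (Suc j)} \<in> edges G" if j: "Suc j < n" for j
  proof -
    consider "j < i" | "j = i" | "j > i" by linarith
    then show ?thesis
    proof cases
      case 3
      then have "r j = Suc (n + i - Suc j)" "r (Suc j) = n + i - Suc j" "Suc (n + i - Suc j) < n"
        using j by (auto simp: r_def)
      then show ?thesis using p by (simp add: ham_path_def n_def insert_commute)
    qed (use p e j i' in \<open>auto simp: r_def ham_path_def n_def insert_commute\<close>)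
  qed
  moreover have "{(g \<circ> r) (n - 1), (g \<circ> r) 0} \<in> edges G"
    using e i' by (auto simp: r_def insert_commute)
  ultimately have "ham_cycle G (g \<circ> r)"
    using i' by (subst ham_cycle_iff_ham_path) (auto simp: ham_path_def n_def)
  then show ?thesis by blast
qed

text \<open>Ore's counting argument: the predecessors of the neighbours of the first vertex and the
  neighbours of the last vertex occupy disjoint sets of positions below \<open>n - 1\<close>,
  because a common position would allow a flip into a Hamilton cycle.\<close>

lemma degree_sum_ham_path_ends:
  assumes G: "simple_graph G" and p: "ham_path G g" and no: "\<nexists>h. ham_cycle G h"
    and n: "order G > 0"
  shows "degree G (g 0) + degree G (g (order G - 1)) < order G"
proof -
  define n where "n = order G"
  define A where "A = {i. i < n - 1 \<and> {g 0, g (Suc i)} \<in> edges G}"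
  define B where "B = {i. i < n - 1 \<and> {g (n - 1), g i} \<in> edges G}"
  have n0: "n > 0" using n by (simp add: n_def)
  have bij: "bij_betw g {..<n} (verts G)" using p by (simp add: ham_path_def n_def)
  have inj: "inj_on g {..<n}" using bij by (simp add: bij_betw_def)
  have index: "\<exists>i<n. x = g i" if "x \<in> verts G" for x
    using bij that by (auto simp: bij_betw_def)
  have "(\<lambda>i. g (Suc i)) ` A = nbhd G (g 0)"
  proof (intro equalityI subsetI)
    fix x assume x: "x \<in> nbhd G (g 0)"
    then obtain i where i: "i < n" "x = g i" using index nbhd_subset_verts[of G] by blast
    moreover have "i \<noteq> 0" using x i not_in_nbhd_self[OF G] by (cases "i = 0") auto
    ultimately show "x \<in> (\<lambda>i. g (Suc i)) ` A"
      using x G by (intro image_eqI[of _ _ "i - 1"]) (auto simp: A_def in_nbhd_iff)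
  qed (auto simp: A_def in_nbhd_iff G)
  moreover have "inj_on (\<lambda>i. g (Suc i)) A"
    by (intro inj_onI) (auto simp: A_def dest: inj_onD[OF inj])
  ultimately have cA: "card A = degree G (g 0)"
    using card_image[of "\<lambda>i. g (Suc i)" A] by (simp add: degree_def)
  have "g ` B = nbhd G (g (n - 1))"
  proof (intro equalityI subsetI)
    fix x assume x: "x \<in> nbhd G (g (n - 1))"
    then obtain i where i: "i < n" "x = g i" using index nbhd_subset_verts[of G] by blast
    moreover have "i \<noteq> n - 1" using x i not_in_nbhd_self[OF G] by (cases "i = n - 1") auto
    ultimately show "x \<in> g ` B"
      using x G by (intro image_eqI[of _ _ i]) (auto simp: B_def in_nbhd_iff)
  qed (auto simp: B_def in_nbhd_iff G)
  moreover have "inj_on g B"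
    using inj by (auto simp: inj_on_def B_def)
  ultimately have cB: "card B = degree G (g (n - 1))"
    using card_image[of g B] by (simp add: degree_def)
  have "i \<notin> B" if "i \<in> A" for i
    using ham_path_flip[OF p, of i] no that n0 by (auto simp: A_def B_def n_def less_diff_conv)
  then have "A \<inter> B = {}" by blast
  moreover have "finite A" "finite B" by (auto simp: A_def B_def)
  ultimately have "card A + card B = card (A \<union> B)" by (simp add: card_Un_disjoint)
  also have "\<dots> \<le> card {..<n - 1}"
    by (rule card_mono) (auto simp: A_def B_def)
  finally show ?thesis using cA cB n0 by (simp add: n_def)
qed

text \<open>The cycle has to use the added edge. Once that edge is rotated to the closing position,
  the rest is a Hamilton path of \<open>G\<close> with ends \<open>u\<close> and
  \<open>v\<close>.\<close>

lemma degree_sum_of_ham_cycle_add_edge: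
  assumes G: "simple_graph G" and no: "\<nexists>h. ham_cycle G h" and n: "order G \<ge> 3"
    and f: "ham_cycle (add_edges G {{u, v}}) f"
  shows "degree G u + degree G v < order G"
proof -
  let ?G = "add_edges G {{u, v}}"
  let ?n = "order G"
  have ord: "order ?G = ?n" by (simp add: add_edges_def order_def)
  have "\<exists>m < ?n. {f m, f (Suc m mod ?n)} \<notin> edges G"
    using no f by (auto simp: ham_cycle_def add_edges_def order_def)
  then obtain m where m: "m < ?n" "{f m, f (Suc m mod ?n)} \<notin> edges G" by blast
  then have uv: "{f m, f (Suc m mod ?n)} = {u, v}"
    using f ord by (auto simp: ham_cycle_def add_edges_def)
  obtain g where g: "ham_cycle ?G g" "g (?n - 1) = f m" "g 0 = f (Suc m mod ?n)"
    using ham_cycle_rotate[OF f, of m] m ord by auto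
  have "ham_path ?G g" using g(1) n ord ham_cycle_iff_ham_path[of ?G g] by auto
  then have bij: "bij_betw g {..<?n} (verts G)"
    and e: "\<And>i. Suc i < ?n \<Longrightarrow> {g i, g (Suc i)} \<in> insert {u, v} (edges G)"
    using ord by (auto simp: ham_path_def add_edges_def)
  \<comment> \<open>The closing edge does not occur a second time along the path. With only two
    vertices it would, hence the bound \<open>order G \<ge> 3\<close>.\<close>
  have "{g i, g (Suc i)} \<noteq> {u, v}" if i: "Suc i < ?n" for i
  proof
    assume "{g i, g (Suc i)} = {u, v}"
    then have "g ` {i, Suc i} = g ` {?n - 1, 0}" using uv g by simp
    then have "{i, Suc i} = {?n - 1, 0}"
      using inj_on_image_eq_iff[of g "{..<?n}" "{i, Suc i}" "{?n - 1, 0}"] bij i n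
      by (auto simp: bij_betw_def)
    then show False using i n by (auto simp: doubleton_eq_iff)
  qed
  then have "ham_path G g" using bij e by (auto simp: ham_path_def)
  then have "degree G (g 0) + degree G (g (?n - 1)) < ?n"
    using degree_sum_ham_path_ends G no n by (metis not_gr0 not_numeral_le_zero)
  moreover have "{g 0, g (?n - 1)} = {u, v}" using g uv by (auto simp: insert_commute)
  ultimately show ?thesis by (auto simp: doubleton_eq_iff)
qed

lemma ham_cycle_of_complete:
  assumes "finite V" "card V \<ge> 3"
  shows "\<exists>f. ham_cycle (Graph V (nsets V 2)) f"
proof -
  obtain f where f: "bij_betw f {..<card V} V"
    using finite_same_card_bij[of "{..<card V}" V] assms by auto
  have "f i \<noteq> f (Suc i mod card V)" if "i < card V" for i
  proof
    assume "f i = f (Suc i mod card V)"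
    moreover have "Suc i mod card V < card V" using assms by simp
    ultimately have "i = Suc i mod card V"
      using f that by (auto simp: bij_betw_def inj_on_def)
    then show False using that assms by (auto simp: mod_Suc split: if_splits)
  qed
  then have "ham_cycle (Graph V (nsets V 2)) f"
    using f assms by (auto simp: ham_cycle_def order_def bij_betw_def)
  then show ?thesis by blast
qed

text \<open>
  Chvatal's argument: a nonadjacent pair \<open>u\<close>, \<open>v\<close> of maximal degree sum in an
  edge-maximal non-Hamiltonian supergraph has degree sum less than \<open>n\<close>, and the vertices
  not adjacent to the one of larger degree have degree at most the smaller one.
\<close>

lemma low_degree_set_if_no_ham_cycle:
  assumes G: "simple_graph G" and no: "\<nexists>f. ham_cycle G f" and n: "order G \<ge> 3"
  obtains S u where "S \<subseteq> verts G" "2 * card S < order G" "\<forall>x \<in> S. degree G x \<le> card S"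
    "u \<in> verts G" "degree G u \<le> card S"
proof -
  let ?V = "verts G"
  have finV: "finite ?V" using G by (rule finite_verts)
  define X where "X = {E. edges G \<subseteq> E \<and> E \<subseteq> nsets ?V 2 \<and> (\<nexists>f. ham_cycle (Graph ?V E) f)}"
  have "finite X"
    by (rule finite_subset[of _ "Pow (nsets ?V 2)"]) (auto simp: X_def finV finite_imp_finite_nsets)
  moreover have "edges G \<in> X"
    using G no unfolding X_def simple_graph_def by (cases G) simp
  ultimately obtain E where E: "E \<in> X" and max: "\<forall>E' \<in> X. E \<subseteq> E' \<longrightarrow> E = E'"
    using finite_has_maximal[of X] by blast
  define H where "H = Graph ?V E"
  have H: "simple_graph H" "verts H = ?V" "edges H = E" "edges G \<subseteq> E" "order H = order G"
    and noH: "\<nexists>f. ham_cycle H f"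
    using E finV unfolding X_def by (auto simp: H_def simple_graph_def order_def)
  define N where "N = {(u, v). u \<in> ?V \<and> v \<in> ?V \<and> u \<noteq> v \<and> {u, v} \<notin> E}"
  have ore: "degree H u + degree H v < order G" if "(u, v) \<in> N" for u v
  proof -
    have uv: "u \<in> ?V" "v \<in> ?V" "u \<noteq> v" "{u, v} \<notin> E" using that by (simp_all add: N_def)
    have "insert {u, v} E \<notin> X" using max uv by auto
    then obtain f where "ham_cycle (Graph ?V (insert {u, v} E)) f"
      using E uv unfolding X_def by auto
    then have "ham_cycle (add_edges H {{u, v}}) f"
      by (simp add: add_edges_def H_def)
    then show ?thesis using degree_sum_of_ham_cycle_add_edge[OF H(1) noH] H(5) n by simp
  qed
  have "E \<noteq> nsets ?V 2"
    using noH ham_cycle_of_complete[OF finV] n by (auto simp: H_def order_def)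
  then obtain e where "e \<in> nsets ?V 2" "e \<notin> E" using E unfolding X_def by blast
  then have "N \<noteq> {}" unfolding N_def by (elim in_nsets2E) blast
  moreover have "finite N"
    by (rule finite_subset[of _ "?V \<times> ?V"]) (auto simp: N_def finV)
  ultimately obtain q where "q \<in> N"
    and q: "Max ((\<lambda>r. degree H (fst r) + degree H (snd r)) ` N) = degree H (fst q) + degree H (snd q)"
    using obtains_MAX by blast
  define u where "u = (if degree H (fst q) \<le> degree H (snd q) then fst q else snd q)"
  define v where "v = (if degree H (fst q) \<le> degree H (snd q) then snd q else fst q)"
  have uv: "(u, v) \<in> N" "degree H u \<le> degree H v"
    using \<open>q \<in> N\<close> by (cases q; auto simp: u_def v_def N_def insert_commute)+
  have le: "degree H x + degree H y \<le> degree H u + degree H v" if "(x, y) \<in> N" for x y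
  proof -
    have "degree H x + degree H y \<le> degree H (fst q) + degree H (snd q)"
      unfolding q[symmetric] using \<open>finite N\<close> that by (intro Max_ge) (auto intro: rev_image_eqI)
    then show ?thesis by (auto simp: u_def v_def)
  qed
  \<comment> \<open>Each vertex of \<open>?T\<close> forms a nonadjacent pair with \<open>v\<close>,
    so maximality of the degree sum of \<open>u\<close> and \<open>v\<close> bounds its degree by
    that of \<open>u\<close>. Since the sum is below \<open>n\<close>, \<open>?T\<close> is large
    enough to contain a set \<open>S\<close> of \<open>degree H u\<close> vertices.\<close>
  let ?T = "?V - insert v (nbhd H v)"
  have T: "degree H x \<le> degree H u" if "x \<in> ?T" for x
    using le[of x v] that H uv by (auto simp: N_def in_nbhd_iff insert_commute)
  have "card ?T = order G - Suc (degree H v)"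
    using H uv nbhd_subset_verts[of H v] not_in_nbhd_self[of H v] finite_nbhd[of H v]
    by (subst card_Diff_subset) (auto simp: order_def degree_def N_def)
  then have "degree H u \<le> card ?T" using ore[OF uv(1)] by simp
  then obtain S where S: "S \<subseteq> ?T" "card S = degree H u"
    by (rule obtain_subset_with_card_n)
  have GH: "degree G x \<le> degree H x" for x using degree_mono[of H G x] H by simp
  \<comment> \<open>The vertex \<open>u\<close> need not lie in \<open>S\<close>. It is returned
    because it shows that the minimum degree is at most \<open>card S\<close>, even if
    \<open>S\<close> is empty.\<close>
  show thesis
  proof (rule that[of S u])
    show "\<forall>x \<in> S. degree G x \<le> card S" using S T GH by (auto intro: order_trans)
  qed (use S uv ore[OF uv(1)] GH in \<open>auto simp: N_def\<close>)
qed


section \<open>Hamilton paths by way of a dominating vertex\<close>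

definition cone :: "'a \<Rightarrow> 'a graph \<Rightarrow> 'a graph" where
  "cone z G = Graph (insert z (verts G)) (edges G \<union> {{z, v} | v. v \<in> verts G})"

lemma simple_graph_cone:
  assumes "simple_graph G" "z \<notin> verts G"
  shows "simple_graph (cone z G)"
proof -
  have "edges G \<subseteq> nsets (insert z (verts G)) 2"
    using assms nsets_mono[of "verts G" "insert z (verts G)" 2] by (auto simp: simple_graph_def)
  then show ?thesis using assms by (auto simp: cone_def simple_graph_def)
qed

lemma order_cone:
  assumes "simple_graph G" "z \<notin> verts G"
  shows "order (cone z G) = Suc (order G)"
  using assms by (simp add: cone_def order_def finite_verts)

lemma degree_cone:
  assumes G: "simple_graph G" and z: "z \<notin> verts G" and x: "x \<in> verts G"
  shows "degree (cone z G) x = Suc (degree G x)"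
proof -
  have "{x, z} \<notin> edges G" using simple_graphD[OF G] z by blast
  then have "nbhd (cone z G) x = insert z (nbhd G x)"
    using x z by (auto simp: nbhd_def cone_def doubleton_eq_iff)
  moreover have "z \<notin> nbhd G x" using z by (simp add: nbhd_def)
  ultimately show ?thesis using G by (simp add: degree_def finite_nbhd)
qed

lemma degree_cone_apex:
  assumes G: "simple_graph G" and z: "z \<notin> verts G"
  shows "degree (cone z G) z = order G"
proof -
  have "nbhd (cone z G) z = verts G"
    using z simple_graphD[OF G] by (auto simp: nbhd_def cone_def doubleton_eq_iff)
  then show ?thesis by (simp add: degree_def order_def)
qed

text \<open>Rotate the cycle until the apex comes last; deleting it leaves a Hamilton path whose
  edges all belong to \<open>G\<close>.\<close>

lemma ham_path_if_ham_cycle_cone: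
  assumes G: "simple_graph G" and z: "z \<notin> verts G" and f: "ham_cycle (cone z G) f"
  shows "\<exists>g. ham_path G g"
proof -
  define n where "n = order G"
  have ord: "order (cone z G) = Suc n" using order_cone[OF G z] by (simp add: n_def)
  have bijf: "bij_betw f {..<Suc n} (insert z (verts G))"
    using f ord by (auto simp: ham_cycle_def cone_def)
  then have "z \<in> f ` {..<Suc n}" by (simp add: bij_betw_def)
  then obtain m where m: "m < Suc n" "f m = z" by auto
  obtain g where "ham_cycle (cone z G) g" "g n = z"
    using ham_cycle_rotate[OF f, of m] m ord by auto
  moreover from this have "ham_path (cone z G) g"
    using ham_cycle_iff_ham_path[of "cone z G" g] ord by simp
  ultimately have bij: "bij_betw g {..<Suc n} (insert z (verts G))" and gn: "g n = z"
    and e: "\<And>i. Suc i < Suc n \<Longrightarrow> {g i, g (Suc i)} \<in> edges (cone z G)"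
    using ord by (auto simp: ham_path_def cone_def)
  have "g ` {..<n} = g ` {..<Suc n} - {z}"
    using bij gn by (auto simp: bij_betw_def inj_on_def lessThan_Suc)
  also have "\<dots> = verts G" using bij z by (simp add: bij_betw_def)
  finally have im: "g ` {..<n} = verts G" .
  moreover have "inj_on g {..<n}"
    using bij by (auto simp: bij_betw_def intro: inj_on_subset)
  moreover have "{g i, g (Suc i)} \<in> edges G" if "Suc i < n" for i
  proof -
    have "g i \<noteq> z" "g (Suc i) \<noteq> z" using im z that by auto
    then show ?thesis using e[of i] that by (auto simp: cone_def doubleton_eq_iff)
  qed
  ultimately have "ham_path G g" by (simp add: ham_path_def bij_betw_def n_def)
  then show ?thesis by blast
qed

text \<open>Passing to the cone raises the order and all old degrees by one, which turns the strict
  bound on \<open>card S\<close> into a weak one and the weak bounds on the degrees into strict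
  ones. Vertices are natural numbers so that a fresh apex exists.\<close>

lemma low_degree_set_if_no_ham_path:
  fixes G :: "nat graph"
  assumes G: "simple_graph G" and no: "\<nexists>f. ham_path G f" and n: "order G \<ge> 2"
  obtains S u where "S \<subseteq> verts G" "2 * card S \<le> order G" "\<forall>x \<in> S. degree G x < card S"
    "u \<in> verts G" "degree G u < card S"
proof -
  obtain z where z: "z \<notin> verts G"
    using finite_verts[OF G] ex_new_if_finite infinite_UNIV_nat by blast
  have "\<nexists>f. ham_cycle (cone z G) f" using ham_path_if_ham_cycle_cone[OF G z] no by blast
  moreover have "order (cone z G) \<ge> 3" using order_cone[OF G z] n by simp
  ultimately obtain S u where S: "S \<subseteq> insert z (verts G)" "2 * card S < Suc (order G)"
    "\<forall>x \<in> S. degree (cone z G) x \<le> card S" "u \<in> insert z (verts G)" "degree (cone z G) u \<le> card S"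
    using low_degree_set_if_no_ham_cycle[OF simple_graph_cone[OF G z]] order_cone[OF G z]
    by (auto simp: cone_def)
  \<comment> \<open>The apex has degree \<open>order G\<close>, which exceeds \<open>card S\<close>;
    so it is neither in \<open>S\<close> nor equal to \<open>u\<close>.\<close>
  have not_z: "\<not> degree (cone z G) z \<le> card S" using degree_cone_apex[OF G z] S(2) n by simp
  show thesis
  proof (rule that[of S u])
    show SV: "S \<subseteq> verts G" using S not_z by auto
    show uV: "u \<in> verts G" using S not_z by auto
    show "degree G u < card S" using S(5) degree_cone[OF G z uV] by simp
    show "\<forall>x \<in> S. degree G x < card S"
    proof
      fix x assume "x \<in> S"
      then have "degree (cone z G) x \<le> card S" "x \<in> verts G" using S(3) SV by blast+
      then show "degree G x < card S" using degree_cone[OF G z] by simp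
    qed
    show "2 * card S \<le> order G" using S(2) by simp
  qed
qed


section \<open>Kelmans operations\<close>

lemma verts_kelmans [simp]: "verts (kelmans G x y) = verts G"
  by (simp add: kelmans_def Let_def)

lemma simple_graph_kelmans:
  assumes "simple_graph G" "y \<in> verts G"
  shows "simple_graph (kelmans G x y)"
proof -
  have "nbhd G x - closed_nbhd G y \<subseteq> verts G - {y}"
    by (auto simp: nbhd_def closed_nbhd_def)
  then show ?thesis
    using assms by (auto simp: simple_graph_def kelmans_def Let_def)
qed

context
  fixes G :: "'a graph" and x y :: 'a and W :: "'a set"
  assumes G: "simple_graph G" and xy: "x \<in> verts G" "y \<in> verts G" "x \<noteq> y"
  defines "W \<equiv> nbhd G x - closed_nbhd G y"
begin

lemma edge_kelmans_iff:
  "{a, b} \<in> edges (kelmans G x y) \<longleftrightarrow>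
    {a, b} \<in> edges G \<and> \<not> (a = x \<and> b \<in> W) \<and> \<not> (b = x \<and> a \<in> W) \<or>
    a = y \<and> b \<in> W \<or> b = y \<and> a \<in> W"
  unfolding kelmans_def Let_def W_def by (auto simp: doubleton_eq_iff)

lemma kelmans_W: "x \<notin> W" "y \<notin> W" "W \<inter> nbhd G y = {}" "W \<subseteq> nbhd G x"
  using not_in_nbhd_self[OF G] by (auto simp: W_def closed_nbhd_def)

lemma nbhd_kelmans_source: "nbhd (kelmans G x y) x = nbhd G x - W"
  using kelmans_W xy by (auto simp: nbhd_def edge_kelmans_iff)

lemma nbhd_kelmans_target: "nbhd (kelmans G x y) y = nbhd G y \<union> W"
  using kelmans_W xy nbhd_subset_verts[of G x] by (auto simp: nbhd_def edge_kelmans_iff)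

lemma nbhd_kelmans_other:
  assumes "z \<noteq> x" "z \<noteq> y"
  shows "nbhd (kelmans G x y) z = (if z \<in> W then insert y (nbhd G z - {x}) else nbhd G z)"
  using assms xy by (auto simp: nbhd_def edge_kelmans_iff)

lemma degree_kelmans_source: "degree (kelmans G x y) x + card W = degree G x"
  using kelmans_W finite_nbhd[OF G, of x]
  by (simp add: degree_def nbhd_kelmans_source card_Diff_subset card_mono finite_subset)

lemma degree_kelmans_target: "degree (kelmans G x y) y = degree G y + card W"
  using kelmans_W finite_nbhd[OF G, of x] finite_nbhd[OF G, of y]
  by (simp add: degree_def nbhd_kelmans_target card_Un_disjoint finite_subset Int_commute)

text \<open>A vertex of \<open>W\<close> exchanges its neighbour \<open>x\<close> for the new
  neighbour \<open>y\<close>; every other vertex keeps its neighbourhood.\<close>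

lemma degree_kelmans_other:
  assumes "z \<noteq> x" "z \<noteq> y"
  shows "degree (kelmans G x y) z = degree G z"
proof (cases "z \<in> W")
  case True
  then have "x \<in> nbhd G z" "y \<notin> nbhd G z"
    using kelmans_W nbhd_sym[OF G] by blast+
  then show ?thesis
    using True assms finite_nbhd[OF G, of z]
    by (simp add: degree_def nbhd_kelmans_other card_Suc_Diff1 del: card_Diff_insert)
next
  case False
  then show ?thesis using assms by (simp add: degree_def nbhd_kelmans_other)
qed

text \<open>The source keeps the common neighbours, and \<open>y\<close> if the two are adjacent. In
  \<open>G\<close>, \<open>y\<close> has these common neighbours, in the adjacent case also
  \<open>x\<close>, and in addition a private neighbour \<open>b\<close>.\<close>

lemma degree_kelmans_source_less:
  assumes "\<not> nbhd G y \<subseteq> closed_nbhd G x"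
  shows "degree (kelmans G x y) x < degree G y"
proof -
  obtain b where b: "b \<in> nbhd G y" "b \<noteq> x" "b \<notin> nbhd G x"
    using assms by (auto simp: closed_nbhd_def)
  let ?C = "nbhd G x \<inter> nbhd G y"
  have fin: "finite ?C" using finite_nbhd[OF G] by blast
  have notC: "x \<notin> ?C" "y \<notin> ?C" "b \<notin> ?C" using not_in_nbhd_self[OF G] b by auto
  have N: "nbhd (kelmans G x y) x = nbhd G x \<inter> closed_nbhd G y"
    unfolding nbhd_kelmans_source W_def by blast
  show ?thesis
  proof (cases "y \<in> nbhd G x")
    case True
    then have "nbhd (kelmans G x y) x = insert y ?C" unfolding N closed_nbhd_def by blast
    then have "degree (kelmans G x y) x = Suc (card ?C)" using fin notC by (simp add: degree_def)
    also have "\<dots> < card (insert x (insert b ?C))" using fin notC b by simp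
    also have "\<dots> \<le> degree G y"
      unfolding degree_def
      by (rule card_mono) (use True b nbhd_sym[OF G] finite_nbhd[OF G] in auto)
    finally show ?thesis .
  next
    case False
    then have "nbhd (kelmans G x y) x = ?C" unfolding N closed_nbhd_def by blast
    then have "degree (kelmans G x y) x = card ?C" by (simp add: degree_def)
    also have "\<dots> < card (insert b ?C)" using fin notC b by simp
    also have "\<dots> \<le> degree G y"
      unfolding degree_def by (rule card_mono) (use b finite_nbhd[OF G] in auto)
    finally show ?thesis .
  qed
qed

end

section \<open>Compression by Kelmans operations\<close>

lemma degree_le_order: "simple_graph G \<Longrightarrow> degree G x \<le> order G"
  unfolding degree_def order_def
  by (intro card_mono finite_verts nbhd_subset_verts)

text \<open>No Kelmans operation with target \<open>y\<close> outside \<open>S\<close> makes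
  progress: either it moves nothing, or both vertices lie outside \<open>S\<close> and it merely
  exchanges their roles. For \<open>x\<close> in \<open>S\<close> the exchange would count as
  progress, hence the asymmetry.\<close>

definition compressed :: "'a set \<Rightarrow> 'a graph \<Rightarrow> bool" where
  "compressed S G \<longleftrightarrow> (\<forall>x \<in> verts G. \<forall>y \<in> verts G - S.
     nbhd G x \<subseteq> closed_nbhd G y \<or> x \<notin> S \<and> nbhd G y \<subseteq> closed_nbhd G x)"

text \<open>
  A graph that maximises the sum of the squared degrees outside \<open>S\<close> is compressed.
\<close>

lemma kelmans_compression:
  fixes P :: "nat graph \<Rightarrow> real"
  assumes P: "weakly_feasible P" and G: "simple_graph G"
  obtains H where "simple_graph H" "verts H = verts G" "\<forall>x \<in> S. degree H x \<le> degree G x"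
    "P G \<le> P H" "compressed S H"
proof -
  let ?V = "verts G"
  define good where "good H \<longleftrightarrow> simple_graph H \<and> verts H = ?V \<and>
    (\<forall>x \<in> S. degree H x \<le> degree G x) \<and> P G \<le> P H" for H
  define \<Phi> where "\<Phi> H = (\<Sum>v \<in> ?V - S. (degree H v)\<^sup>2)" for H
  define b where "b = card (?V - S) * (order G)\<^sup>2"
  have finV: "finite ?V" using G by (rule finite_verts)
  have bound: "\<Phi> H \<le> b" if "good H" for H
  proof -
    have "degree H v \<le> order G" for v
      using degree_le_order[of H v] that by (simp add: good_def order_def)
    then have "\<Phi> H \<le> (\<Sum>v \<in> ?V - S. (order G)\<^sup>2)"
      unfolding \<Phi>_def by (intro sum_mono power_mono) auto
    then show ?thesis by (simp add: b_def)
  qed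
  have "good G" using G by (simp add: good_def)
  \<comment> \<open>The potential is bounded on good graphs, so a good graph of greatest potential
    exists.\<close>
  then obtain H where H: "good H" and max: "\<And>H'. good H' \<Longrightarrow> \<Phi> H' \<le> \<Phi> H"
    using ex_has_greatest_nat[of good G \<Phi> "Suc b"] bound by (auto simp: less_Suc_eq_le)
  have simple: "simple_graph H" and V: "verts H = ?V" using H by (auto simp: good_def)
  have "nbhd H x \<subseteq> closed_nbhd H y \<or> x \<notin> S \<and> nbhd H y \<subseteq> closed_nbhd H x"
    if x: "x \<in> ?V" and y: "y \<in> ?V - S" for x y
  proof (rule ccontr)
    assume neg: "\<not> (nbhd H x \<subseteq> closed_nbhd H y \<or> x \<notin> S \<and> nbhd H y \<subseteq> closed_nbhd H x)"
    then have xy: "x \<noteq> y" by (auto simp: closed_nbhd_def)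
    let ?K = "kelmans H x y"
    let ?W = "nbhd H x - closed_nbhd H y"
    have xyH: "x \<in> verts H" "y \<in> verts H" using x y V by auto
    note deg = degree_kelmans_source[OF simple xyH xy] degree_kelmans_target[OF simple xyH xy]
      degree_kelmans_other[OF simple xyH xy]
    have W: "card ?W > 0" using neg finite_nbhd[OF simple, of x] by (auto simp: card_gt_0_iff)
    have "P H \<le> P ?K" using P simple xyH xy by (auto simp: weakly_feasible_def)
    moreover have "degree ?K z \<le> degree G z" if "z \<in> S" for z
    proof -
      have "z \<noteq> y" using that y by auto
      then have "degree ?K z \<le> degree H z" using deg(1) deg(3)[of z] by (cases "z = x") auto
      also have "\<dots> \<le> degree G z" using H that by (simp add: good_def)
      finally show ?thesis .
    qed
    ultimately have "good ?K"
      using H simple_graph_kelmans[OF simple xyH(2)] unfolding good_def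
      by (auto intro: order_trans)
    then have "\<Phi> ?K \<le> \<Phi> H" by (rule max)
    moreover have "\<Phi> H < \<Phi> ?K"
    proof (cases "x \<in> S")
      \<comment> \<open>Here \<open>x\<close> does not contribute to the potential, so the growth of
        the degree of \<open>y\<close> decides.\<close>
      case True
      have "(\<Sum>v \<in> ?V - S - {y}. (degree ?K v)\<^sup>2) = (\<Sum>v \<in> ?V - S - {y}. (degree H v)\<^sup>2)"
      proof (intro sum.cong refl)
        fix z assume "z \<in> ?V - S - {y}"
        then have "z \<noteq> x" "z \<noteq> y" using True by auto
        then show "(degree ?K z)\<^sup>2 = (degree H z)\<^sup>2" using deg(3) by simp
      qed
      moreover have "(degree H y)\<^sup>2 < (degree ?K y)\<^sup>2"
        using deg(2) W by (intro power_strict_mono) auto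
      ultimately show ?thesis
        using finV y by (simp add: \<Phi>_def sum.remove[of "?V - S" y])
    next
      case False
      then have less: "degree ?K x < degree H y"
        using neg degree_kelmans_source_less[OF simple xyH xy] by blast
      have "(\<Sum>v \<in> ?V - S - {y} - {x}. (degree ?K v)\<^sup>2) = (\<Sum>v \<in> ?V - S - {y} - {x}. (degree H v)\<^sup>2)"
        using deg(3) by (intro sum.cong) auto
      \<comment> \<open>With \<open>a\<close> the new degree of \<open>x\<close>, \<open>b\<close>
        the old degree of \<open>y\<close> and \<open>w\<close> the size of \<open>?W\<close>, the
        degrees change from \<open>a + w\<close>, \<open>b\<close> to \<open>a\<close>,
        \<open>b + w\<close>. The sum of squares grows by \<open>2 * w * (b - a)\<close>, and
        \<open>a < b\<close>.\<close>
      moreover have "(degree H x)\<^sup>2 + (degree H y)\<^sup>2 < (degree ?K x)\<^sup>2 + (degree ?K y)\<^sup>2"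
        unfolding deg(1)[symmetric] deg(2) using less W by (simp add: power2_sum)
      ultimately show ?thesis
        using finV x y xy False
        by (simp add: \<Phi>_def sum.remove[of "?V - S" y] sum.remove[of "?V - S - {y}" x])
    qed
    ultimately show False by simp
  qed
  then have "compressed S H" by (simp add: compressed_def V)
  then show thesis using H that by (auto simp: good_def)
qed

text \<open>For \<open>K\<close> disjoint from \<open>S\<close> this is the join of a clique on
  \<open>K\<close> with the disjoint union of an edgeless graph on \<open>S\<close> and a clique on
  the rest. It is the common form of \<open>H_graph\<close> and \<open>L_graph\<close>, on an
  arbitrary vertex set and free of the even and odd labels.\<close>

definition split_join :: "'a set \<Rightarrow> 'a set \<Rightarrow> 'a set \<Rightarrow> 'a graph" where
  "split_join V S K = Graph V {e \<in> nsets V 2. e \<inter> K \<noteq> {} \<or> e \<inter> S = {}}"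

lemma verts_split_join [simp]: "verts (split_join V S K) = V"
  by (simp add: split_join_def)

lemma edge_split_join_iff:
  "{x, y} \<in> edges (split_join V S K) \<longleftrightarrow>
    x \<in> V \<and> y \<in> V \<and> x \<noteq> y \<and> (x \<in> K \<or> y \<in> K \<or> x \<notin> S \<and> y \<notin> S)"
  by (auto simp: split_join_def)

lemma simple_graph_split_join: "finite V \<Longrightarrow> simple_graph (split_join V S K)"
  by (auto simp: split_join_def simple_graph_def)

lemma compressed_subset_split_join:
  assumes H: "simple_graph H" and comp: "compressed S H" and S: "S \<subseteq> verts H"
    and deg: "\<forall>x \<in> S. degree H x \<le> k" and k: "k + card S < order H"
  obtains K where "K \<subseteq> verts H - S" "card K = k" "edges H \<subseteq> edges (split_join (verts H) S K)"
proof -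
  let ?V = "verts H"
  have finV: "finite ?V" using H by (rule finite_verts)
  then have finS: "finite S" using S by (rule rev_finite_subset)
  have cVS: "k < card (?V - S)"
    using k S finS finV by (simp add: card_Diff_subset order_def)
  have indep: "w' \<notin> nbhd H w" if w: "w \<in> S" "w' \<in> S" for w w'
  proof
    assume adj: "w' \<in> nbhd H w"
    have "?V - S \<subseteq> nbhd H w'"
    proof
      fix y assume y: "y \<in> ?V - S"
      then have "nbhd H w \<subseteq> closed_nbhd H y" using comp w S unfolding compressed_def by blast
      then have "w' \<in> nbhd H y" using adj y w by (auto simp: closed_nbhd_def)
      then show "y \<in> nbhd H w'" using nbhd_sym[OF H] by blast
    qed
    then have "card (?V - S) \<le> degree H w'"
      unfolding degree_def using finite_nbhd[OF H] by (rule card_mono[rotated])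
    then show False using cVS deg w by (meson leD le_trans)
  qed
  \<comment> \<open>If the neighbourhoods of \<open>w\<close> and \<open>w'\<close> were
    incomparable, private neighbours \<open>z\<close> and \<open>z'\<close> would lie outside
    \<open>S\<close> by independence. Then \<open>w\<close> and \<open>w'\<close> would witness that
    the neighbourhoods of \<open>z\<close> and \<open>z'\<close> are not nested, against
    compression.\<close>
  have chain: "nbhd H w' \<subseteq> nbhd H w" if w: "w \<in> S" "w' \<in> S" and le: "degree H w' \<le> degree H w" for w w'
  proof (rule ccontr)
    assume "\<not> nbhd H w' \<subseteq> nbhd H w"
    then obtain z' where z': "z' \<in> nbhd H w'" "z' \<notin> nbhd H w" by blast
    have "\<not> nbhd H w \<subseteq> nbhd H w'"
    proof
      assume "nbhd H w \<subseteq> nbhd H w'"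
      then have "nbhd H w \<subset> nbhd H w'" using z' by blast
      then have "degree H w < degree H w'"
        unfolding degree_def using finite_nbhd[OF H] by (rule psubset_card_mono[rotated])
      then show False using le by simp
    qed
    then obtain z where z: "z \<in> nbhd H w" "z \<notin> nbhd H w'" by blast
    have zS: "z \<in> ?V - S" "z' \<in> ?V - S"
      using z(1) z'(1) indep w nbhd_subset_verts[of H] by blast+
    have "w \<in> nbhd H z" "w' \<in> nbhd H z'" using z z' nbhd_sym[OF H] by blast+
    moreover have "w \<notin> closed_nbhd H z'" "w' \<notin> closed_nbhd H z"
      using z(2) z'(2) nbhd_sym[OF H] zS w unfolding closed_nbhd_def by blast+
    ultimately show False using comp zS unfolding compressed_def by blast
  qed
  \<comment> \<open>By the chain property the neighbourhood of a vertex of largest degree in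
    \<open>S\<close> contains all the others.\<close>
  obtain K0 where K0: "K0 \<subseteq> ?V - S" "card K0 \<le> k" "\<And>w. w \<in> S \<Longrightarrow> nbhd H w \<subseteq> K0"
  proof (cases "S = {}")
    case True
    then show thesis using that[of "{}"] by simp
  next
    case False
    then obtain w where w: "w \<in> S" "Max (degree H ` S) = degree H w"
      using obtains_MAX[OF finS] by blast
    have "degree H v \<le> degree H w" if "v \<in> S" for v
      unfolding w(2)[symmetric] using finS that by (intro Max_ge) auto
    moreover have "nbhd H w \<subseteq> ?V - S" using indep w(1) nbhd_subset_verts[of H w] by blast
    moreover have "card (nbhd H w) \<le> k" using deg w(1) by (simp add: degree_def)
    ultimately show thesis using that[of "nbhd H w"] w(1) chain by blast
  qed
  \<comment> \<open>There is room to enlarge \<open>K0\<close> to exactly \<open>k\<close> vertices,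
    since more than \<open>k\<close> vertices lie outside \<open>S\<close>.\<close>
  obtain K where K: "K0 \<subseteq> K" "K \<subseteq> ?V - S" "card K = k"
    using exists_subset_between[OF K0(2) _ K0(1)] cVS finV by auto
  have "edges H \<subseteq> edges (split_join ?V S K)"
  proof
    fix e assume e: "e \<in> edges H"
    then have "e \<in> nsets ?V 2" using H by (auto simp: simple_graph_def)
    then obtain x y where xy: "e = {x, y}" by (rule in_nsets2E)
    have adj: "y \<in> nbhd H x" "x \<in> nbhd H y"
      using e xy H by (auto simp: in_nbhd_iff insert_commute)
    have "y \<in> K" if "x \<in> S" using K0(3)[OF that] K(1) adj by blast
    moreover have "x \<in> K" if "y \<in> S" using K0(3)[OF that] K(1) adj by blast
    ultimately show "e \<in> edges (split_join ?V S K)"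
      using simple_graphD[OF H] e xy by (auto simp: edge_split_join_iff)
  qed
  then show thesis using that K by blast
qed


text \<open>A vertex of \<open>K\<close> is adjacent to all others. Connectedness is what (W1)
  demands of the enlarged graph.\<close>

lemma connected_split_join:
  assumes "K \<subseteq> V" "K \<noteq> {}"
  shows "connected_graph (split_join V S K)"
proof -
  obtain c where c: "c \<in> K" "c \<in> V" using assms by blast
  let ?R = "{(x, y). {x, y} \<in> edges (split_join V S K)}"
  have "(u, c) \<in> ?R\<^sup>* \<and> (c, u) \<in> ?R\<^sup>*" if "u \<in> V" for u
  proof (cases "u = c")
    case False
    then have "(u, c) \<in> ?R" "(c, u) \<in> ?R"
      using c that by (auto simp: edge_split_join_iff)
    then show ?thesis by blast
  qed simp
  then show ?thesis unfolding connected_graph_def by (auto intro: rtrancl_trans)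
qed

text \<open>Compression does not lower \<open>P\<close> by (W2), and filling up to the split join
  does not by (W1). The parameter \<open>k\<close> is \<open>card S\<close> for cycles and
  \<open>card S - 1\<close> for paths.\<close>

lemma low_degree_set_bound:
  fixes P :: "nat graph \<Rightarrow> real"
  assumes P: "weakly_feasible P" and G: "simple_graph G" and S: "S \<subseteq> verts G"
    and deg: "\<forall>x \<in> S. degree G x \<le> k" and k: "k > 0" "k + card S < order G"
  obtains K where "K \<subseteq> verts G - S" "card K = k" "P G \<le> P (split_join (verts G) S K)"
proof -
  obtain H where H: "simple_graph H" "verts H = verts G" "\<forall>x \<in> S. degree H x \<le> degree G x"
    "P G \<le> P H" "compressed S H"
    using kelmans_compression[OF P G] by blast
  have "\<forall>x \<in> S. degree H x \<le> k" using H(3) deg order_trans by blast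
  then obtain K where K: "K \<subseteq> verts G - S" "card K = k"
    and sub: "edges H \<subseteq> edges (split_join (verts G) S K)"
    using compressed_subset_split_join[OF H(1) H(5), of k] S H(2) k(2) by (auto simp: order_def)
  let ?J = "split_join (verts G) S K"
  have "K \<noteq> {}" using K(2) k(1) by auto
  then have conn: "connected_graph ?J" using K(1) by (intro connected_split_join) auto
  have J: "add_edges H (edges ?J - edges H) = ?J"
    using sub H(2) by (intro graph.expand) (auto simp: add_edges_def)
  have "edges ?J \<subseteq> nsets (verts H) 2" using H(2) by (auto simp: split_join_def)
  then have "P H \<le> P (add_edges H (edges ?J - edges H))"
    using P H(1) conn J unfolding weakly_feasible_def by (metis Diff_mono order_refl)
  then show thesis using that K H(4) J by simp
qed

text \<open>Adjacency depends only on membership in \<open>S\<close> and \<open>K\<close>, so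
  bijections between the three corresponding blocks can be glued.\<close>

lemma graph_iso_split_join:
  assumes fin: "finite V" "finite V'" and sub: "S \<subseteq> V" "K \<subseteq> V - S" "S' \<subseteq> V'" "K' \<subseteq> V' - S'"
    and card: "card V = card V'" "card S = card S'" "card K = card K'"
  shows "graph_iso (split_join V S K) (split_join V' S' K')"
proof -
  have fins: "finite S" "finite S'" "finite K" "finite K'"
    using fin sub by (auto intro: finite_subset)
  let ?R = "V - S - K" and ?R' = "V' - S' - K'"
  have "card ?R = card ?R'"
    using fins sub card by (simp add: card_Diff_subset)
  then obtain h where h: "bij_betw h ?R ?R'"
    using finite_same_card_bij[of ?R ?R'] fin by auto
  obtain f g where f: "bij_betw f S S'" and g: "bij_betw g K K'"
    using finite_same_card_bij fins card by meson
  define \<phi> where "\<phi> x = (if x \<in> S then f x else if x \<in> K then g x else h x)" for x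
  have S: "bij_betw \<phi> S S'" using f by (rule bij_betw_cong[THEN iffD1, rotated]) (simp add: \<phi>_def)
  have K: "bij_betw \<phi> K K'"
    using g by (rule bij_betw_cong[THEN iffD1, rotated]) (use sub in \<open>auto simp: \<phi>_def\<close>)
  have SK: "bij_betw \<phi> (S \<union> K) (S' \<union> K')"
    using sub by (intro bij_betw_combine[OF S K]) auto
  have R: "bij_betw \<phi> ?R ?R'"
    using h by (rule bij_betw_cong[THEN iffD1, rotated]) (auto simp: \<phi>_def)
  have "bij_betw \<phi> (S \<union> K \<union> ?R) (S' \<union> K' \<union> ?R')"
    by (intro bij_betw_combine[OF SK R]) auto
  moreover have "S \<union> K \<union> ?R = V" "S' \<union> K' \<union> ?R' = V'" using sub by auto
  ultimately have bij: "bij_betw \<phi> V V'" by simp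
  have inj: "inj_on \<phi> V" using bij by (simp add: bij_betw_def)
  have S_iff: "\<phi> x \<in> S' \<longleftrightarrow> x \<in> S" and K_iff: "\<phi> x \<in> K' \<longleftrightarrow> x \<in> K" if "x \<in> V" for x
  proof -
    have "S' = \<phi> ` S" "K' = \<phi> ` K" using S K by (simp_all add: bij_betw_def)
    moreover have "K \<subseteq> V" using sub by blast
    ultimately show "\<phi> x \<in> S' \<longleftrightarrow> x \<in> S" "\<phi> x \<in> K' \<longleftrightarrow> x \<in> K"
      using inj_on_image_mem_iff[OF inj that] sub(1) by simp_all
  qed
  have "{x, y} \<in> edges (split_join V S K) \<longleftrightarrow> {\<phi> x, \<phi> y} \<in> edges (split_join V' S' K')"
    if xy: "x \<in> V" "y \<in> V" for x y
  proof -
    have "\<phi> x \<in> V'" "\<phi> y \<in> V'" using bij xy by (auto dest: bij_betwE)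
    then show ?thesis
      using xy by (simp add: edge_split_join_iff S_iff K_iff inj_on_eq_iff[OF inj])
  qed
  then show ?thesis using bij unfolding graph_iso_def by auto
qed

section \<open>Minimum degree and non-Hamiltonicity of split joins\<close>

lemma min_degree_split_join:
  assumes V: "finite V" "V \<noteq> {}" and sub: "S \<subseteq> V" "K \<subseteq> V - S" and d: "d \<le> card S" "d \<le> card K"
  shows "d \<le> min_degree (split_join V S K)"
proof -
  have "d \<le> degree (split_join V S K) x" if x: "x \<in> V" for x
  proof -
    let ?N = "nbhd (split_join V S K) x"
    have fin: "finite ?N" using V by (simp add: nbhd_def)
    show ?thesis
    proof (cases "x \<in> K")
      case True
      then have "S \<subseteq> ?N" using sub x unfolding nbhd_def by (auto simp: edge_split_join_iff)
      then have "card S \<le> card ?N" using fin by (intro card_mono)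
      then show ?thesis using d by (simp add: degree_def)
    next
      case False
      then have "K \<subseteq> ?N" using sub x by (auto simp: nbhd_def edge_split_join_iff)
      then have "card K \<le> card ?N" using fin by (intro card_mono)
      then show ?thesis using d by (simp add: degree_def)
    qed
  qed
  then show ?thesis using V by (simp add: min_degree_def)
qed

text \<open>The cyclic predecessors of \<open>A\<close> form a set of size \<open>card A\<close>
  inside \<open>B\<close>, hence all of \<open>B\<close>. So \<open>A\<close> is followed by
  \<open>B\<close> and \<open>B\<close> by \<open>A\<close>, and the union, being closed under
  successors, is the whole cycle.\<close>

lemma cyclic_alternation:
  fixes A B :: "nat set"
  assumes sub: "A \<subseteq> {..<m}" "B \<subseteq> {..<m}" and card: "card B \<le> card A" and ne: "A \<noteq> {}"
    and after: "\<And>i. i \<in> A \<Longrightarrow> Suc i mod m \<in> B"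
    and before: "\<And>i. i < m \<Longrightarrow> Suc i mod m \<in> A \<Longrightarrow> i \<in> B"
  shows "A \<union> B = {..<m}"
proof -
  define \<sigma> where "\<sigma> i = Suc i mod m" for i
  have m: "m > 0" using sub ne by auto
  have inj: "inj_on \<sigma> {..<m}"
    by (auto simp: inj_on_def \<sigma>_def mod_Suc split: if_splits)
  moreover have "\<sigma> ` {..<m} \<subseteq> {..<m}" using m by (auto simp: \<sigma>_def)
  ultimately have surj: "\<sigma> ` {..<m} = {..<m}" by (intro endo_inj_surj) auto
  define C where "C = {i. i < m \<and> \<sigma> i \<in> A}"
  have "\<sigma> ` C = A" using sub surj by (auto simp: C_def)
  moreover have "inj_on \<sigma> C" using inj by (rule inj_on_subset) (auto simp: C_def)
  ultimately have "card C = card A" by (metis card_image)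
  moreover have "C \<subseteq> B" using before by (auto simp: C_def \<sigma>_def)
  moreover have "finite B" using sub(2) by (rule finite_subset) simp
  ultimately have "C = B" using card by (metis card_mono card_subset_eq le_antisym)
  then have closed: "Suc i mod m \<in> A \<union> B" if "i \<in> A \<union> B" for i
    using that after by (auto simp: C_def \<sigma>_def)
  obtain a where a: "a \<in> A" "a < m" using ne sub by auto
  have reach: "(a + j) mod m \<in> A \<union> B" for j
  proof (induction j)
    case (Suc j)
    then show ?case using closed[of "(a + j) mod m"] by (simp add: mod_Suc_eq)
  qed (use a in simp)
  \<comment> \<open>Starting at \<open>a\<close>, \<open>m - a + i\<close> steps lead to position
    \<open>i\<close> after one full wrap.\<close>
  have "i \<in> A \<union> B" if "i < m" for i
    using reach[of "m - a + i"] a that by simp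
  then show ?thesis using sub by auto
qed

lemma card_positions:
  assumes f: "bij_betw f {..<n} V" and X: "X \<subseteq> V"
  shows "card {i. i < n \<and> f i \<in> X} = card X"
proof -
  have "bij_betw f {i. i < n \<and> f i \<in> X} X"
    using f X by (auto simp: bij_betw_def inj_on_def)
  then show ?thesis by (rule bij_betw_same_card)
qed

text \<open>
  Along a Hamilton cycle or path, the neighbours of every vertex of \<open>S\<close> lie in \<open>K\<close>.
\<close>

lemma no_ham_cycle_split_join:
  assumes V: "finite V" and sub: "S \<subseteq> V" "K \<subseteq> V - S"
    and card: "card K \<le> card S" "S \<noteq> {}" "card S + card K < card V"
  shows "\<not> ham_cycle (split_join V S K) f"
proof
  assume f: "ham_cycle (split_join V S K) f"
  define n where "n = card V"
  have bij: "bij_betw f {..<n} V"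
    and e: "\<And>i. i < n \<Longrightarrow> {f i, f (Suc i mod n)} \<in> edges (split_join V S K)"
    using f by (auto simp: ham_cycle_def order_def n_def)
  define A B where "A = {i. i < n \<and> f i \<in> S}" and "B = {i. i < n \<and> f i \<in> K}"
  have cards: "card A = card S" "card B = card K"
    using card_positions[OF bij] sub by (auto simp: A_def B_def)
  have fins: "finite S" using sub V by (auto intro: finite_subset)
  have "A \<union> B = {..<n}"
  proof (rule cyclic_alternation)
    show "A \<noteq> {}" using cards card fins by auto
    show "Suc i mod n \<in> B" if "i \<in> A" for i
      using e[of i] that sub by (auto simp: A_def B_def edge_split_join_iff)
    show "i \<in> B" if "i < n" "Suc i mod n \<in> A" for i
      using e[of i] that sub by (auto simp: A_def B_def edge_split_join_iff)
  qed (use cards card in \<open>auto simp: A_def B_def\<close>)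
  moreover have "card (A \<union> B) \<le> card A + card B" by (rule card_Un_le)
  ultimately show False using cards card by (simp add: n_def)
qed

lemma no_ham_path_split_join:
  assumes V: "finite V" and sub: "S \<subseteq> V" "K \<subseteq> V - S"
    and card: "card K < card S" "card S + card K < card V"
  shows "\<not> ham_path (split_join V S K) f"
proof
  assume f: "ham_path (split_join V S K) f"
  define n where "n = card V"
  have bij: "bij_betw f {..<n} V"
    and e: "\<And>i. Suc i < n \<Longrightarrow> {f i, f (Suc i)} \<in> edges (split_join V S K)"
    using f by (auto simp: ham_path_def order_def n_def)
  \<comment> \<open>The position \<open>n\<close> closes the path to a cycle; it counts as a member of \<open>K\<close>.\<close>
  define A B where "A = {i. i < n \<and> f i \<in> S}" and "B = insert n {i. i < n \<and> f i \<in> K}"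
  have cards: "card A = card S" "card B = Suc (card K)"
    using card_positions[OF bij] sub by (auto simp: A_def B_def)
  have "A \<union> B = {..<Suc n}"
  proof (rule cyclic_alternation)
    show "A \<noteq> {}" using cards card by auto
    show "Suc i mod Suc n \<in> B" if "i \<in> A" for i
    proof (cases "Suc i = n")
      case False
      then show ?thesis
        using e[of i] that sub by (auto simp: A_def B_def edge_split_join_iff)
    qed (simp add: B_def)
    show "i \<in> B" if "i < Suc n" "Suc i mod Suc n \<in> A" for i
    proof (cases "i = n")
      case False
      then show ?thesis
        using e[of i] that sub by (auto simp: A_def B_def edge_split_join_iff)
    qed (simp add: B_def)
  qed (use cards card in \<open>auto simp: A_def B_def\<close>)
  \<comment> \<open>All \<open>n + 1\<close> positions would be covered by at most
    \<open>card S + card K + 1\<close> elements, although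
    \<open>card S + card K < n\<close>.\<close>
  moreover have "card (A \<union> B) \<le> card A + card B" by (rule card_Un_le)
  ultimately show False using cards card by (simp add: n_def)
qed


section \<open>The extremal graphs\<close>

lemma join_eq_split_join:
  obtains V S K where
    "join (complete_graph k) (disjoint_union (edgeless_graph s) (complete_graph r)) = split_join V S K"
    "finite V" "S \<subseteq> V" "K \<subseteq> V - S" "card V = k + s + r" "card S = s" "card K = k"
proof -
  let ?J = "join (complete_graph k) (disjoint_union (edgeless_graph s) (complete_graph r))"
  \<comment> \<open>The nested disjoint unions put \<open>K\<close> on the even numbers,
    \<open>S\<close> on numbers congruent to 1 modulo 4, and the remaining clique on those congruent
    to 3.\<close>
  define K where "K = (\<lambda>i::nat. 2 * i) ` {..<k}"
  define S where "S = (\<lambda>i::nat. 2 * (2 * i) + 1) ` {..<s}"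
  define R where "R = (\<lambda>i::nat. 2 * (2 * i + 1) + 1) ` {..<r}"
  have disj: "K \<inter> S = {}" "(K \<union> S) \<inter> R = {}"
    by (auto simp: K_def S_def R_def) presburger+
  have fin: "finite K" "finite S" "finite R" by (auto simp: K_def S_def R_def)
  have cards: "card K = k" "card S = s" "card R = r"
    unfolding K_def S_def R_def by (simp_all add: card_image inj_on_def)
  let ?V = "K \<union> S \<union> R"
  have verts: "verts ?J = ?V"
    by (simp add: join_def add_edges_def disjoint_union_def map_verts_def Let_def complete_graph_def
        edgeless_graph_def K_def S_def R_def image_Un image_image Un_assoc)
  have edges: "edges ?J = (`) (\<lambda>i. 2 * i) ` nsets {..<k} 2 \<union>
      (`) (\<lambda>i. 2 * (2 * i + 1) + 1) ` nsets {..<r} 2 \<union>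
      {{2 * u, 2 * v + 1} | u v. u < k \<and> v \<in> (\<lambda>i. 2 * i) ` {..<s} \<union> (\<lambda>i. 2 * i + 1) ` {..<r}}"
    by (simp add: join_def add_edges_def disjoint_union_def map_verts_def Let_def complete_graph_def
        edgeless_graph_def image_image)
  have "e \<in> edges ?J \<longleftrightarrow> e \<in> edges (split_join ?V S K)" for e
  proof
    assume "e \<in> edges ?J"
    then consider (K) "e \<in> (`) (\<lambda>i. 2 * i) ` nsets {..<k} 2"
      | (R) "e \<in> (`) (\<lambda>i. 2 * (2 * i + 1) + 1) ` nsets {..<r} 2"
      | (KSR) u v where "e = {2 * u, 2 * v + 1}" "u < k"
          "v \<in> (\<lambda>i. 2 * i) ` {..<s} \<union> (\<lambda>i. 2 * i + 1) ` {..<r}"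
      unfolding edges by blast
    then show "e \<in> edges (split_join ?V S K)"
    proof cases
      case K
      then obtain a b where "e = {2 * a, 2 * b}" "a < k" "b < k" "a \<noteq> b"
        by (auto elim!: in_nsets2E)
      then show ?thesis by (auto simp: edge_split_join_iff K_def)
    next
      case R
      then obtain a b where ab: "e = {2 * (2 * a + 1) + 1, 2 * (2 * b + 1) + 1}" "a < r" "b < r" "a \<noteq> b"
        by (auto elim!: in_nsets2E)
      then have "2 * (2 * a + 1) + 1 \<in> R" "2 * (2 * b + 1) + 1 \<in> R" by (auto simp: R_def)
      then show ?thesis using ab disj unfolding ab(1) edge_split_join_iff by auto
    next
      case KSR
      then have "2 * u \<in> K" "2 * v + 1 \<in> S \<union> R" by (auto simp: K_def S_def R_def)
      then show ?thesis using disj unfolding KSR(1) edge_split_join_iff by auto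
    qed
  next
    assume e: "e \<in> edges (split_join ?V S K)"
    then have "e \<in> nsets ?V 2" by (simp add: split_join_def)
    then obtain x y where xy: "e = {x, y}" by (rule in_nsets2E)
    have cross: "{x, y} \<in> edges ?J" if "x \<in> K" "y \<in> S \<union> R" for x y
      using that unfolding edges K_def S_def R_def by blast
    have inK: "{x, y} \<in> edges ?J" if xy: "x \<in> K" "y \<in> K" "x \<noteq> y" for x y
    proof -
      obtain a b where "x = 2 * a" "y = 2 * b" "{a, b} \<in> nsets {..<k} 2"
        using xy by (auto simp: K_def)
      then show ?thesis unfolding edges by (intro UnI1 image_eqI[of _ _ "{a, b}"]) auto
    qed
    have inR: "{x, y} \<in> edges ?J" if xy: "x \<in> R" "y \<in> R" "x \<noteq> y" for x y
    proof -
      obtain a b where "x = 2 * (2 * a + 1) + 1" "y = 2 * (2 * b + 1) + 1" "{a, b} \<in> nsets {..<r} 2"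
        using xy by (auto simp: R_def)
      then show ?thesis
        unfolding edges by (intro UnI1[OF UnI2] image_eqI[of _ _ "{a, b}"]) auto
    qed
    have "x \<in> ?V" "y \<in> ?V" "x \<noteq> y" "x \<in> K \<or> y \<in> K \<or> x \<notin> S \<and> y \<notin> S"
      using e unfolding xy edge_split_join_iff by auto
    then consider "x \<in> K" "y \<in> K" "x \<noteq> y" | "x \<in> K" "y \<in> S \<union> R" | "y \<in> K" "x \<in> S \<union> R"
      | "x \<in> R" "y \<in> R" "x \<noteq> y" by blast
    then show "e \<in> edges ?J"
      unfolding xy using inK cross[of x y] cross[of y x] inR by cases (auto simp: insert_commute)
  qed
  then have "?J = split_join ?V S K"
    using verts by (intro graph.expand) auto
  moreover have "card ?V = k + s + r" using fin disj cards by (simp add: card_Un_disjoint)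
  ultimately show thesis using that[of ?V S K] fin disj cards by auto
qed

lemma H_graph_split_join:
  assumes "2 * s \<le> n"
  obtains V S K where "H_graph n s = split_join V S K"
    "finite V" "S \<subseteq> V" "K \<subseteq> V - S" "card V = n" "card S = s" "card K = s"
  using assms join_eq_split_join[of s s "n - 2 * s"] unfolding H_graph_def
  by (metis add_diff_inverse_nat linorder_not_less mult_2)

lemma L_graph_split_join:
  assumes "2 * s \<le> n" "s > 0"
  obtains V S K where "L_graph n s = split_join V S K"
    "finite V" "S \<subseteq> V" "K \<subseteq> V - S" "card V = n" "card S = s" "card K = s - 1"
proof -
  have "s - 1 + s + (n - 2 * s + 1) = n" using assms by simp
  then show thesis
    using that join_eq_split_join[of "s - 1" s "n - 2 * s + 1"] unfolding L_graph_def by metis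
qed

section \<open>Upper bounds by the extremal families\<close>

context
  fixes P :: "nat graph \<Rightarrow> real"
  assumes param: "graph_parameter P" and feas: "weakly_feasible P"
begin

lemma split_join_cong:
  assumes "finite V" "finite V'" "S \<subseteq> V" "K \<subseteq> V - S" "S' \<subseteq> V'" "K' \<subseteq> V' - S'"
    and "card V = card V'" "card S = card S'" "card K = card K'"
  shows "P (split_join V S K) = P (split_join V' S' K')"
  using param graph_iso_split_join[OF assms] assms(1,2) simple_graph_split_join
  unfolding graph_parameter_def by blast

lemma cycle_upper_bound:
  assumes G: "G \<in> admissible n (cycle_graph n) d" and d: "d \<ge> 1" "n \<ge> 2 * d + 1"
  shows "\<exists>s \<in> {d..(n - 1) div 2}. P G \<le> P (H_graph n s)"
proof -
  have simple: "simple_graph G" and ord: "order G = n" and min: "d \<le> min_degree G"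
    and no: "\<nexists>f. ham_cycle G f"
    using G contains_cycle_iff[of G] by (auto simp: admissible_def simple_graph_def)
  obtain S u where S: "S \<subseteq> verts G" "2 * card S < n" "\<forall>x \<in> S. degree G x \<le> card S"
    and u: "u \<in> verts G" "degree G u \<le> card S"
    using low_degree_set_if_no_ham_cycle[OF simple no] ord d by auto
  \<comment> \<open>The extra vertex \<open>u\<close> ties the minimum degree to the size of
    \<open>S\<close>; this gives the lower end of the range of \<open>s\<close>.\<close>
  have ds: "d \<le> card S" using min_degree_le[OF simple u(1)] min u(2) by simp
  obtain K where K: "K \<subseteq> verts G - S" "card K = card S" "P G \<le> P (split_join (verts G) S K)"
    using low_degree_set_bound[OF feas simple S(1,3)] ds d S(2) ord by auto
  obtain V' S' K' where "H_graph n (card S) = split_join V' S' K'"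
    "finite V'" "S' \<subseteq> V'" "K' \<subseteq> V' - S'" "card V' = n" "card S' = card S" "card K' = card S"
    using H_graph_split_join[of "card S" n] S(2) by auto
  then have "P G \<le> P (H_graph n (card S))"
    using K S(1) ord finite_verts[OF simple] split_join_cong[of "verts G" V' S K S' K']
    by (simp add: order_def)
  moreover have "card S \<in> {d..(n - 1) div 2}" using ds S(2) by auto
  ultimately show ?thesis by blast
qed

lemma path_upper_bound:
  assumes G: "G \<in> admissible n (path_graph n) d" and d: "d \<ge> 1" "n \<ge> 2 * d + 2"
  shows "\<exists>s \<in> {d + 1..n div 2}. P G \<le> P (L_graph n s)"
proof -
  have simple: "simple_graph G" and ord: "order G = n" and min: "d \<le> min_degree G"
    and no: "\<nexists>f. ham_path G f"
    using G contains_path_iff[of G] by (auto simp: admissible_def simple_graph_def)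
  obtain S u where S: "S \<subseteq> verts G" "2 * card S \<le> n" "\<forall>x \<in> S. degree G x < card S"
    and u: "u \<in> verts G" "degree G u < card S"
    using low_degree_set_if_no_ham_path[OF simple no] ord d by auto
  have ds: "d < card S" using min_degree_le[OF simple u(1)] min u(2) by simp
  \<comment> \<open>Since \<open>card S\<close> is positive, \<open>2 * card S \<le> n\<close>
    already yields the strict inequality for \<open>k = card S - 1\<close>.\<close>
  have small: "card S - 1 + card S < order G" using ds S(2) ord by linarith
  have "\<forall>x \<in> S. degree G x \<le> card S - 1" using S(3) by auto
  then obtain K where K: "K \<subseteq> verts G - S" "card K = card S - 1"
    "P G \<le> P (split_join (verts G) S K)"
    using low_degree_set_bound[OF feas simple S(1), of "card S - 1"] small ds d by auto
  obtain V' S' K' where "L_graph n (card S) = split_join V' S' K'"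
    "finite V'" "S' \<subseteq> V'" "K' \<subseteq> V' - S'" "card V' = n" "card S' = card S" "card K' = card S - 1"
    using L_graph_split_join[of "card S" n] S(2) ds by auto
  then have "P G \<le> P (L_graph n (card S))"
    using K S(1) ord finite_verts[OF simple] split_join_cong[of "verts G" V' S K S' K']
    by (simp add: order_def)
  moreover have "card S \<in> {d + 1..n div 2}" using ds S(2) by auto
  ultimately show ?thesis by blast
qed

end

section \<open>Admissibility of the extremal graphs and the two maxima\<close>

lemma H_graph_admissible:
  assumes "d \<ge> 1" "d \<le> s" "2 * s < n"
  shows "H_graph n s \<in> admissible n (cycle_graph n) d"
proof -
  obtain V S K where H: "H_graph n s = split_join V S K" and V: "finite V" "S \<subseteq> V" "K \<subseteq> V - S"
    and card: "card V = n" "card S = s" "card K = s"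
    using H_graph_split_join[of s n] assms by auto
  have "V \<noteq> {}" "S \<noteq> {}" using card assms by auto
  \<comment> \<open>The strict inequality \<open>2 * s < n\<close> leaves a vertex outside
    \<open>S\<close> and \<open>K\<close>, which a Hamilton cycle alternating between the two could
    not reach.\<close>
  then have "d \<le> min_degree (split_join V S K)" "\<nexists>f. ham_cycle (split_join V S K) f"
    using min_degree_split_join[of V S K d] no_ham_cycle_split_join[OF V] V card assms by auto
  then show ?thesis
    using contains_cycle_iff[of "split_join V S K"] V card simple_graph_split_join
    by (simp add: H admissible_def order_def)
qed

lemma L_graph_admissible:
  assumes "d < s" "2 * s \<le> n"
  shows "L_graph n s \<in> admissible n (path_graph n) d"
proof -
  obtain V S K where L: "L_graph n s = split_join V S K" and V: "finite V" "S \<subseteq> V" "K \<subseteq> V - S"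
    and card: "card V = n" "card S = s" "card K = s - 1"
    using L_graph_split_join[of s n] assms by auto
  have "V \<noteq> {}" using card assms by auto
  \<comment> \<open>From \<open>d < s\<close> the set \<open>K\<close>, of size
    \<open>s - 1\<close>, still has at least \<open>d\<close> vertices.\<close>
  then have "d \<le> min_degree (split_join V S K)" "\<nexists>f. ham_path (split_join V S K) f"
    using min_degree_split_join[of V S K d] no_ham_path_split_join[OF V] V card assms by auto
  then show ?thesis
    using contains_path_iff[of "split_join V S K"] V card simple_graph_split_join
    by (simp add: L admissible_def order_def)
qed

text \<open>For use with \<open>A\<close> the values on all admissible graphs and \<open>B\<close>
  those on the extremal family: admissibility gives the inclusion, the upper bounds give the
  domination.\<close>

lemma Max_eq_Max_of_cofinal_subset:
  fixes A B :: "'a::linorder set"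
  assumes "finite A" "B \<subseteq> A" "B \<noteq> {}" "\<And>a. a \<in> A \<Longrightarrow> \<exists>b \<in> B. a \<le> b"
  shows "Max A = Max B"
proof (rule antisym)
  have "finite B" using assms finite_subset by blast
  then show "Max A \<le> Max B"
    using assms by (subst Max_le_iff) (auto simp: Max_ge_iff)
  show "Max B \<le> Max A" using assms by (intro Max_mono)
qed

theorem theorem2p3:
  fixes P :: "nat graph \<Rightarrow> real"
  assumes "graph_parameter P" and "weakly_feasible P"
  shows "(\<forall>d n :: nat. d \<ge> 1 \<and> n \<ge> 2 * d + 1 \<longrightarrow>
            ex_param P n (cycle_graph n) d = (MAX s \<in> {d..(n - 1) div 2}. P (H_graph n s))) \<and>
         (\<forall>d n :: nat. d \<ge> 1 \<and> n \<ge> 2 * d + 2 \<longrightarrow>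
            ex_param P n (path_graph n) d = (MAX s \<in> {d + 1..n div 2}. P (L_graph n s)))"
proof (intro conjI allI impI)
  fix d n :: nat assume dn: "d \<ge> 1 \<and> n \<ge> 2 * d + 1"
  show "ex_param P n (cycle_graph n) d = (MAX s \<in> {d..(n - 1) div 2}. P (H_graph n s))"
    unfolding ex_param_def
  proof (rule Max_eq_Max_of_cofinal_subset)
    show "finite (P ` admissible n (cycle_graph n) d)" using assms(1) by (rule finite_values)
    show "(\<lambda>s. P (H_graph n s)) ` {d..(n - 1) div 2} \<subseteq> P ` admissible n (cycle_graph n) d"
      using dn by (intro image_subsetI imageI H_graph_admissible) auto
    show "(\<lambda>s. P (H_graph n s)) ` {d..(n - 1) div 2} \<noteq> {}" using dn by auto
    show "\<exists>b \<in> (\<lambda>s. P (H_graph n s)) ` {d..(n - 1) div 2}. a \<le> b"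
      if "a \<in> P ` admissible n (cycle_graph n) d" for a
      using that cycle_upper_bound[OF assms] dn by blast
  qed
next
  fix d n :: nat assume dn: "d \<ge> 1 \<and> n \<ge> 2 * d + 2"
  show "ex_param P n (path_graph n) d = (MAX s \<in> {d + 1..n div 2}. P (L_graph n s))"
    unfolding ex_param_def
  proof (rule Max_eq_Max_of_cofinal_subset)
    show "finite (P ` admissible n (path_graph n) d)" using assms(1) by (rule finite_values)
    show "(\<lambda>s. P (L_graph n s)) ` {d + 1..n div 2} \<subseteq> P ` admissible n (path_graph n) d"
      using dn by (intro image_subsetI imageI L_graph_admissible) auto
    show "(\<lambda>s. P (L_graph n s)) ` {d + 1..n div 2} \<noteq> {}" using dn by auto
    show "\<exists>b \<in> (\<lambda>s. P (L_graph n s)) ` {d + 1..n div 2}. a \<le> b"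
      if "a \<in> P ` admissible n (path_graph n) d" for a
      using that path_upper_bound[OF assms] dn by blast
  qed
qed

end
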